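(* Let $(X,\sigma)$ be a subshift. If $G$ is a finitely generated subgroup of $\mathrm{Aut}(X)$ and $g\in G$ is distorted in $G$, then $g$ is range distorted and the topological entropy $h_{\mathrm{top}}(g)$ of the homeomorphism $g\colon X\to X$ equals $0$.
   Context: Let $\Sigma$ be a finite alphabet with the discrete topology and give $\Sigma^{\mathbb Z}$ the product topology. The left shift $\sigma\colon\Sigma^{\mathbb Z}\to\Sigma^{\mathbb Z}$ is $(\sigma x)[n]=x[n+1]$. A subshift $(X,\sigma)$ is a closed set $X\subset\Sigma^{\mathbb Z}$ invariant under $\sigma$. $\mathrm{Aut}(X)$ is the group (under composition) of homeomorphisms $\phi\colon X\to X$ with $\phi\circ\sigma=\sigma\circ\phi$. For $\phi\in\mathrm{Aut}(X)$, $\mathrm{range}(\phi)$ is the least nonnegative integer $R$ such that for all $x,y\in X$ with $x[i]=y[i]$ for $-R\le i\le R$ one has $\phi(x)[0]=\phi(y)[0]$ (such an $R$ exists by the Curtis-Hedlund-Lyndon Theorem). An element $\phi\in\mathrm{Aut}(X)$ is range distorted if $\lim_{n\to\infty}\frac{\mathrm{range}(\phi^n)}{n}=0$ (the limit exists by subadditivity). An element $g$ of infinite order in a countable group $G$ is distorted if there is a finite set $S\subset G$ (with $g\in\langle S\rangle$) such that $\lim_{n\to\infty}\frac{\ell_S(g^n)}{n}=0$, where $\ell_S$ denotes word length in the group $\langle S\rangle$ with respect to the generating set $S$ (and inverses of its elements). *)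

theory Defs
  imports
    "HOL-Analysis.Function_Topology"
    "HOL-Library.Extended_Real"
    "HOL-Algebra.Bij"
    "HOL-Algebra.Generated_Groups"
    "HOL-Algebra.Multiplicative_Group"
begin

section \<open>Subshifts and their automorphism groups\<close>

definition full_shift :: "(int \<Rightarrow> 'a::finite) topology" where
  "full_shift = product_topology (\<lambda>_. discrete_topology UNIV) UNIV"

definition shift :: "(int \<Rightarrow> 'a) \<Rightarrow> int \<Rightarrow> 'a" where
  "shift x = (\<lambda>n. x (n + 1))"

definition subshift :: "(int \<Rightarrow> 'a::finite) set \<Rightarrow> bool" where
  "subshift X \<longleftrightarrow> closedin full_shift X \<and> shift ` X = X"

text \<open>Automorphisms are extensional, so that an element of the group is determined by its
  values on the subshift; the group is a subgroup of the library's group of bijections.\<close>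

definition shift_auts :: "(int \<Rightarrow> 'a::finite) set \<Rightarrow> ((int \<Rightarrow> 'a) \<Rightarrow> int \<Rightarrow> 'a) set" where
  "shift_auts X =
    {\<phi> \<in> extensional X.
       homeomorphic_map (subtopology full_shift X) (subtopology full_shift X) \<phi> \<and>
       (\<forall>x\<in>X. \<phi> (shift x) = shift (\<phi> x))}"

definition aut_group :: "(int \<Rightarrow> 'a::finite) set \<Rightarrow> ((int \<Rightarrow> 'a) \<Rightarrow> int \<Rightarrow> 'a) monoid" where
  "aut_group X = (BijGroup X)\<lparr>carrier := shift_auts X\<rparr>"

lemma topspace_full_shift [simp]: "topspace full_shift = UNIV"
  by (simp add: full_shift_def PiE_UNIV_domain)

lemma shift_auts_subset_Bij: "shift_auts X \<subseteq> Bij X"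
proof
  fix f assume f: "f \<in> shift_auts X"
  let ?T = "subtopology full_shift X"
  have hom: "homeomorphic_map ?T ?T f" using f by (simp add: shift_auts_def)
  have "inj_on f X" using homeomorphic_imp_injective_map[OF hom] by simp
  moreover have "f ` X = X" using homeomorphic_imp_surjective_map[OF hom] by simp
  ultimately show "f \<in> Bij X" using f by (simp add: shift_auts_def Bij_def bij_betw_def)
qed

lemma subgroup_shift_auts:
  assumes "subshift X"
  shows "subgroup (shift_auts X) (BijGroup X)"
proof (rule group.subgroupI[OF group_BijGroup])
  let ?T = "subtopology full_shift X"
  have shift_mem: "shift x \<in> X" if "x \<in> X" for x
    using assms that by (auto simp: subshift_def)
  show "shift_auts X \<subseteq> carrier (BijGroup X)"
    using shift_auts_subset_Bij by (auto simp: BijGroup_def)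
  have "homeomorphic_map ?T ?T (\<lambda>x\<in>X. x)"
    by (rule homeomorphic_map_eq[of _ _ id]) auto
  then show "shift_auts X \<noteq> {}"
    using shift_mem by (auto simp: shift_auts_def intro!: exI[of _ "\<lambda>x\<in>X. x"])
next
  let ?T = "subtopology full_shift X"
  have shift_mem: "shift x \<in> X" if "x \<in> X" for x
    using assms that by (auto simp: subshift_def)
  fix f assume f: "f \<in> shift_auts X"
  then have fB: "f \<in> Bij X" using shift_auts_subset_Bij by blast
  then have bij: "bij_betw f X X" by (simp add: Bij_def)
  have inv: "inv\<^bsub>BijGroup X\<^esub> f = restrict (inv_into X f) X"
    using fB by (rule inv_BijGroup)
  obtain h where h: "homeomorphic_maps ?T ?T f h"
    using f homeomorphic_map_maps unfolding shift_auts_def by blast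
  have inv_mem: "inv_into X f x \<in> X" if "x \<in> X" for x
    using bij that by (metis bij_betw_imp_surj_on inv_into_into)
  have "h x = inv_into X f x" if x: "x \<in> X" for x
  proof -
    have "h x \<in> X" "f (h x) = x"
      using h x by (auto simp: homeomorphic_maps_def continuous_map_def)
    then show ?thesis using bij by (metis bij_betw_def inv_into_f_f)
  qed
  moreover have "homeomorphic_map ?T ?T h"
    using h homeomorphic_maps_sym homeomorphic_map_maps by blast
  ultimately have hom: "homeomorphic_map ?T ?T (restrict (inv_into X f) X)"
    by (elim homeomorphic_map_eq) auto
  have "inv_into X f (shift x) = shift (inv_into X f x)" if x: "x \<in> X" for x
  proof -
    have "f (shift (inv_into X f x)) = shift x"
      using f x inv_mem bij by (auto simp: shift_auts_def bij_betw_def f_inv_into_f)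
    then show ?thesis
      using bij shift_mem inv_mem x by (metis bij_betw_def inv_into_f_f)
  qed
  then show "inv\<^bsub>BijGroup X\<^esub> f \<in> shift_auts X"
    using hom shift_mem unfolding inv by (auto simp: shift_auts_def)
next
  let ?T = "subtopology full_shift X"
  have shift_mem: "shift x \<in> X" if "x \<in> X" for x
    using assms that by (auto simp: subshift_def)
  fix f g assume fg: "f \<in> shift_auts X" "g \<in> shift_auts X"
  then have B: "f \<in> Bij X" "g \<in> Bij X" using shift_auts_subset_Bij by blast+
  have g_mem: "g x \<in> X" if "x \<in> X" for x
    using B that by (auto simp: Bij_def bij_betw_def)
  have "homeomorphic_map ?T ?T (f \<circ> g)"
    using fg by (auto simp: shift_auts_def intro: homeomorphic_map_compose)
  then have "homeomorphic_map ?T ?T (compose X f g)"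
    by (rule homeomorphic_map_eq) (auto simp: compose_def)
  then show "f \<otimes>\<^bsub>BijGroup X\<^esub> g \<in> shift_auts X"
    using fg B g_mem shift_mem by (auto simp: BijGroup_def shift_auts_def compose_def)
qed

lemma group_aut_group: "subshift X \<Longrightarrow> group (aut_group X)"
  unfolding aut_group_def
  by (intro group.subgroup_imp_group group_BijGroup subgroup_shift_auts)


section \<open>Range distortion\<close>

definition aut_range :: "(int \<Rightarrow> 'a) set \<Rightarrow> ((int \<Rightarrow> 'a) \<Rightarrow> int \<Rightarrow> 'a) \<Rightarrow> nat" where
  "aut_range X \<phi> =
    (LEAST R. \<forall>x\<in>X. \<forall>y\<in>X. (\<forall>i\<in>{- int R..int R}. x i = y i) \<longrightarrow> \<phi> x 0 = \<phi> y 0)"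

definition range_distorted ::
    "(int \<Rightarrow> 'a::finite) set \<Rightarrow> ((int \<Rightarrow> 'a) \<Rightarrow> int \<Rightarrow> 'a) \<Rightarrow> bool" where
  "range_distorted X \<phi> \<longleftrightarrow>
    \<phi> \<in> carrier (aut_group X) \<and>
    (\<lambda>n. real (aut_range X (\<phi> [^]\<^bsub>aut_group X\<^esub> n)) / real n) \<longlonglongrightarrow> 0"


section \<open>Distorted group elements\<close>

definition word_length :: "('g, 'm) monoid_scheme \<Rightarrow> 'g set \<Rightarrow> 'g \<Rightarrow> nat" where
  "word_length G S g =
    (LEAST n. \<exists>w. length w = n \<and> set w \<subseteq> S \<union> (\<lambda>s. inv\<^bsub>G\<^esub> s) ` S \<and>
       foldr (\<otimes>\<^bsub>G\<^esub>) w \<one>\<^bsub>G\<^esub> = g)"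

text \<open>In the library, an element has order \<open>0\<close> precisely if it has infinite order.\<close>

definition distorted :: "('g, 'm) monoid_scheme \<Rightarrow> 'g \<Rightarrow> bool" where
  "distorted G g \<longleftrightarrow>
    g \<in> carrier G \<and> group.ord G g = 0 \<and>
    (\<exists>S. finite S \<and> S \<subseteq> carrier G \<and> g \<in> generate G S \<and>
       (\<lambda>n. real (word_length G S (g [^]\<^bsub>G\<^esub> n)) / real n) \<longlonglongrightarrow> 0)"


section \<open>Topological entropy\<close>

text \<open>The definition of Adler, Konheim and McAndrew through open covers of a compact space.\<close>

definition open_cover :: "'b topology \<Rightarrow> 'b set set \<Rightarrow> bool" where
  "open_cover T \<U> \<longleftrightarrow> (\<forall>U\<in>\<U>. openin T U) \<and> topspace T \<subseteq> \<Union>\<U>"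

definition min_subcover :: "'b topology \<Rightarrow> 'b set set \<Rightarrow> nat" where
  "min_subcover T \<U> =
    (LEAST k. \<exists>\<V>\<subseteq>\<U>. finite \<V> \<and> card \<V> = k \<and> topspace T \<subseteq> \<Union>\<V>)"

text \<open>The join of the preimages of the cover under the first \<open>n\<close> iterates of \<open>f\<close>
  (exponents \<open>0, \<dots>, n - 1\<close>).\<close>

definition join_preimages ::
    "'b topology \<Rightarrow> ('b \<Rightarrow> 'b) \<Rightarrow> 'b set set \<Rightarrow> nat \<Rightarrow> 'b set set" where
  "join_preimages T f \<U> n =
    {{x \<in> topspace T. \<forall>i<n. (f ^^ i) x \<in> U i} | U. \<forall>i<n. U i \<in> \<U>}"

definition cover_entropy :: "'b topology \<Rightarrow> ('b \<Rightarrow> 'b) \<Rightarrow> 'b set set \<Rightarrow> real" where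
  "cover_entropy T f \<U> =
    lim (\<lambda>n. ln (real (min_subcover T (join_preimages T f \<U> n))) / real n)"

definition topological_entropy :: "'b topology \<Rightarrow> ('b \<Rightarrow> 'b) \<Rightarrow> ereal" where
  "topological_entropy T f = (SUP \<U>\<in>{\<U>. open_cover T \<U>}. ereal (cover_entropy T f \<U>))"

end

(* The range is subadditive under composition, so the range of a word is at most its length
   times the largest range of a letter, and distortion forces sublinear growth of
   range (g^n).  For the entropy, an open cover has a Lebesgue number: the cylinder of some
   fixed radius N around a point lies in a member of the cover.  Hence the cylinder of radius
   N + max {range (g^i) | i < n} around a point lies in a member of the n-th join, and a
   minimal subcover of the join has at most exponentially many members in this sublinear
   radius. *)
theory Submission
  imports Defs "HOL-Library.Cardinality"
begin

section \<open>Cylinders and the Curtis-Hedlund-Lyndon theorem\<close>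

text \<open>The set \<open>{y. agree N x y}\<close> is the cylinder of radius \<open>N\<close>
  around \<open>x\<close>. As \<open>agree N\<close> is an equivalence relation, cylinders of one
  radius partition the full shift, like balls of an ultrametric.\<close>

definition agree :: "nat \<Rightarrow> (int \<Rightarrow> 'a) \<Rightarrow> (int \<Rightarrow> 'a) \<Rightarrow> bool" where
  "agree N x y \<longleftrightarrow> (\<forall>i\<in>{- int N..int N}. x i = y i)"

lemma agree_mono: "agree N x y \<Longrightarrow> M \<le> N \<Longrightarrow> agree M x y"
  by (auto simp: agree_def)

lemma agree_sym: "agree N x y \<Longrightarrow> agree N y x"
  by (auto simp: agree_def)

lemma agree_trans: "agree N x y \<Longrightarrow> agree N y z \<Longrightarrow> agree N x z"
  by (auto simp: agree_def)

lemma agree_refl: "agree N x x"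
  by (auto simp: agree_def)

text \<open>Cylinders of radius \<open>N\<close> correspond to words on the central window, which
  makes them countable by \<open>card_PiE\<close>.\<close>

lemma agree_restrict_iff:
  "agree N x y \<longleftrightarrow> restrict x {- int N..int N} = restrict y {- int N..int N}"
  by (auto simp: agree_def fun_eq_iff restrict_def)

lemma openin_cylinder: "openin full_shift {y. agree N x y}"
proof -
  have "{y. agree N x y} = (\<Pi>\<^sub>E i\<in>UNIV. if i \<in> {- int N..int N} then {x i} else UNIV)"
    by (auto simp: agree_def PiE_iff split: if_splits)
  moreover have "openin full_shift \<dots>"
    unfolding full_shift_def openin_PiE_gen
    by (intro disjI2 conjI) (auto intro: finite_subset[of _ "{- int N..int N}"])
  ultimately show ?thesis by simp
qed

text \<open>A basic open box constrains only finitely many coordinates, so any radius that reaches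
  all of them will do.\<close>

lemma openin_full_shift_cylinder:
  assumes "openin full_shift V" "x \<in> V"
  obtains N where "{y. agree N x y} \<subseteq> V"
proof -
  obtain U where U: "finite {i. U i \<noteq> UNIV}" "x \<in> Pi\<^sub>E UNIV U" "Pi\<^sub>E UNIV U \<subseteq> V"
    using assms by (auto simp: full_shift_def openin_product_topology_alt)
  obtain k where k: "\<And>i. U i \<noteq> UNIV \<Longrightarrow> \<bar>i\<bar> \<le> k"
  proof -
    have "finite (abs ` {i. U i \<noteq> UNIV})" using U(1) by simp
    from bdd_above_finite[OF this] that show thesis
      unfolding bdd_above_def by blast
  qed
  have "{y. agree (nat k) x y} \<subseteq> Pi\<^sub>E UNIV U"
  proof safe
    fix y i assume "agree (nat k) x y"
    show "y i \<in> U i"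
    proof (cases "U i = UNIV")
      case False
      from k[OF this] have "i \<in> {- int (nat k)..int (nat k)}" by auto
      with \<open>agree (nat k) x y\<close> have "x i = y i" unfolding agree_def by blast
      then show ?thesis using U(2) by (metis PiE_iff UNIV_I)
    qed simp
  qed simp
  from that[OF order_trans[OF this U(3)]] show thesis .
qed

section \<open>Compactness of subshifts and Lebesgue numbers of open covers\<close>

lemma compactin_subshift: "subshift X \<Longrightarrow> compactin full_shift X"
proof -
  assume "subshift X"
  have "compact_space (full_shift :: (int \<Rightarrow> 'a) topology)"
    by (simp add: full_shift_def compact_space_product_topology compact_space_discrete_topology)
  with \<open>subshift X\<close> show ?thesis
    by (auto simp: subshift_def intro: closedin_compact_space)
qed

lemma Lebesgue_number_subshift:
  assumes "subshift X" "open_cover (subtopology full_shift X) \<U>"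
  obtains N where "\<And>x. x \<in> X \<Longrightarrow> \<exists>U\<in>\<U>. {y \<in> X. agree N x y} \<subseteq> U"
proof -
  have "\<exists>N. \<exists>U\<in>\<U>. {y \<in> X. agree N x y} \<subseteq> U" if x: "x \<in> X" for x
  proof -
    obtain U where U: "U \<in> \<U>" "x \<in> U" "openin (subtopology full_shift X) U"
      using assms(2) x by (auto simp: open_cover_def)
    then obtain V where V: "openin full_shift V" "U = V \<inter> X"
      by (auto simp: openin_subtopology)
    with U obtain N where "{y. agree N x y} \<subseteq> V"
      using openin_full_shift_cylinder by blast
    with V U show ?thesis by blast
  qed
  then obtain r where r: "\<And>x. x \<in> X \<Longrightarrow> \<exists>U\<in>\<U>. {y \<in> X. agree (r x) x y} \<subseteq> U"
    by metis
  let ?C = "\<lambda>x. {y. agree (r x) x y}"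
  obtain \<F> where \<F>: "finite \<F>" "\<F> \<subseteq> ?C ` X" "X \<subseteq> \<Union>\<F>"
    using compactin_subshift[OF assms(1)] unfolding compactin_def
    by (elim conjE allE[of _ "?C ` X"]) (auto simp: openin_cylinder intro: agree_refl)
  obtain F where "F \<subseteq> X" "finite F" "\<F> = ?C ` F"
    using finite_subset_image[OF \<F>(1,2)] by blast
  with \<F>(3) have F: "finite F" "F \<subseteq> X" "X \<subseteq> (\<Union>x\<in>F. ?C x)" by simp_all
  show thesis
  proof (rule that)
    fix x assume "x \<in> X"
    then obtain z where z: "z \<in> F" "agree (r z) z x" using F by blast
    have le: "r z \<le> Max (r ` F)" using F z by simp
    \<comment> \<open>The ultrametric property: \<open>z\<close> and \<open>x\<close> share their
      cylinder of radius \<open>r z\<close>, so the largest of the finitely many radii serves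
      without any halving.\<close>
    have sub: "{y \<in> X. agree (Max (r ` F)) x y} \<subseteq> {y \<in> X. agree (r z) z y}"
      using agree_trans[OF z(2) agree_mono[OF _ le]] by blast
    obtain U where "U \<in> \<U>" "{y \<in> X. agree (r z) z y} \<subseteq> U" using r z(1) F(2) by blast
    with sub show "\<exists>U\<in>\<U>. {y \<in> X. agree (Max (r ` F)) x y} \<subseteq> U"
      by (intro bexI[of _ U]) (rule order_trans)
  qed
qed

text \<open>Unlike the least value \<open>aut_range\<close>, this predicate is monotone in
  \<open>R\<close>, so upper bounds can be combined before passing to the minimum.\<close>

definition has_range :: "(int \<Rightarrow> 'a) set \<Rightarrow> nat \<Rightarrow> ((int \<Rightarrow> 'a) \<Rightarrow> int \<Rightarrow> 'a) \<Rightarrow> bool" where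
  "has_range X R \<phi> \<longleftrightarrow> (\<forall>x\<in>X. \<forall>y\<in>X. agree R x y \<longrightarrow> \<phi> x 0 = \<phi> y 0)"

lemma aut_range_eq_Least: "aut_range X \<phi> = (LEAST R. has_range X R \<phi>)"
  by (simp add: aut_range_def has_range_def agree_def)

lemma has_range_mono: "has_range X R \<phi> \<Longrightarrow> R \<le> R' \<Longrightarrow> has_range X R' \<phi>"
  unfolding has_range_def by (blast intro: agree_mono)

lemma aut_range_le: "has_range X R \<phi> \<Longrightarrow> aut_range X \<phi> \<le> R"
  unfolding aut_range_eq_Least by (rule Least_le)

lemma shift_auts_mem: "\<phi> \<in> shift_auts X \<Longrightarrow> x \<in> X \<Longrightarrow> \<phi> x \<in> X"
  using shift_auts_subset_Bij Bij_imp_funcset by blast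

text \<open>This is the Curtis-Hedlund-Lyndon theorem: continuity makes the level sets of
  \<open>\<phi> x 0\<close> an open cover, and a Lebesgue number of that cover is an admissible
  radius, so the \<open>LEAST\<close> is attained.\<close>

lemma has_range_aut_range:
  assumes "subshift X" "\<phi> \<in> shift_auts X"
  shows "has_range X (aut_range X \<phi>) \<phi>"
proof -
  let ?T = "subtopology full_shift X"
  let ?U = "range (\<lambda>a. {x \<in> topspace ?T. \<phi> x \<in> {y \<in> X. y 0 = a}})"
  have cont: "continuous_map ?T ?T \<phi>"
    using assms(2) by (simp add: shift_auts_def homeomorphic_imp_continuous_map)
  have "openin ?T {y \<in> X. y 0 = a}" for a
  proof -
    have "openin full_shift {y \<in> topspace full_shift. y (0::int) \<in> {a}}"
      unfolding full_shift_def
      by (rule openin_continuous_map_preimage[OF continuous_map_product_projection]) auto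
    moreover have "{y \<in> X. y 0 = a} = {y. y 0 = a} \<inter> X" by auto
    ultimately show ?thesis by (auto simp: openin_subtopology)
  qed
  from openin_continuous_map_preimage[OF cont this] have "open_cover ?T ?U"
    using shift_auts_mem[OF assms(2)] unfolding open_cover_def by auto
  from Lebesgue_number_subshift[OF assms(1) this] obtain N where
    N: "\<And>x. x \<in> X \<Longrightarrow> \<exists>U\<in>?U. {y \<in> X. agree N x y} \<subseteq> U" by blast
  have "has_range X N \<phi>"
    unfolding has_range_def
  proof (intro ballI impI)
    fix x y assume xy: "x \<in> X" "y \<in> X" "agree N x y"
    from N[OF xy(1)] obtain a where
      "{y \<in> X. agree N x y} \<subseteq> {x \<in> topspace ?T. \<phi> x \<in> {y \<in> X. y 0 = a}}"
      by blast
    with xy agree_refl[of N x] have "\<phi> x 0 = a" "\<phi> y 0 = a" by blast+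
    then show "\<phi> x 0 = \<phi> y 0" by simp
  qed
  then show ?thesis unfolding aut_range_eq_Least by (rule LeastI)
qed

section \<open>Subadditivity of the range\<close>

text \<open>Commutation with the shift carries the local rule from coordinate 0 to every coordinate
  \<open>k\<close>, by induction on \<open>k\<close> in both directions.\<close>

lemma has_range_at:
  assumes "subshift X" "\<phi> \<in> shift_auts X" "has_range X R \<phi>"
    and "x \<in> X" "y \<in> X" "\<And>i. i \<in> {k - int R..k + int R} \<Longrightarrow> x i = y i"
  shows "\<phi> x k = \<phi> y k"
proof -
  have comm: "\<phi> (shift z) = shift (\<phi> z)" if "z \<in> X" for z
    using assms(2) that by (simp add: shift_auts_def)
  have X: "shift ` X = X" using assms(1) by (simp add: subshift_def)
  show ?thesis using assms(4-6)
  proof (induction k arbitrary: x y rule: int_induct[of _ 0])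
    case base
    then have "agree R x y" by (simp add: agree_def)
    with base show ?case using assms(3) unfolding has_range_def by blast
  next
    case (step1 k)
    have "\<phi> (shift x) k = \<phi> (shift y) k"
      using step1.prems X by (intro step1.IH) (auto simp: shift_def)
    then show ?case using step1.prems comm by (simp add: shift_def)
  next
    case (step2 k)
    \<comment> \<open>Going down needs preimages under the shift, which exist in \<open>X\<close>
      because \<open>shift\<close> maps \<open>X\<close> onto itself.\<close>
    obtain x' y' where xy: "x' \<in> X" "y' \<in> X" "x = shift x'" "y = shift y'"
      using step2.prems(1,2) imageE[of _ shift X] unfolding X by metis
    have "\<phi> x' k = \<phi> y' k"
    proof (rule step2.IH)
      fix i assume "i \<in> {k - int R..k + int R}"
      then show "x' i = y' i" using step2.prems(3)[of "i - 1"] xy by (simp add: shift_def)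
    qed (use xy in auto)
    then show ?case using xy comm by (simp add: shift_def)
  qed
qed

lemma agree_image:
  assumes "subshift X" "\<phi> \<in> shift_auts X" "has_range X R \<phi>"
    and "x \<in> X" "y \<in> X" "agree (N + R) x y"
  shows "agree N (\<phi> x) (\<phi> y)"
  unfolding agree_def
proof
  fix k assume "k \<in> {- int N..int N}"
  then show "\<phi> x k = \<phi> y k"
    using assms(6) by (intro has_range_at[OF assms(1-5)]) (auto simp: agree_def)
qed

section \<open>Ranges of products and words in the automorphism group\<close>

lemma carrier_aut_group: "carrier (aut_group X) = shift_auts X"
  by (simp add: aut_group_def)

lemma mult_aut_group:
  "\<phi> \<in> shift_auts X \<Longrightarrow> \<psi> \<in> shift_auts X \<Longrightarrow> \<phi> \<otimes>\<^bsub>aut_group X\<^esub> \<psi> = compose X \<phi> \<psi>"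
  using shift_auts_subset_Bij[of X] by (auto simp: aut_group_def BijGroup_def)

lemma one_aut_group: "\<one>\<^bsub>aut_group X\<^esub> = (\<lambda>x\<in>X. x)"
  by (simp add: aut_group_def BijGroup_def)

lemma has_range_one: "has_range X 0 \<one>\<^bsub>aut_group X\<^esub>"
  by (simp add: has_range_def agree_def one_aut_group)

text \<open>Agreement of radius \<open>R + R'\<close> becomes agreement of radius \<open>R\<close>
  after \<open>\<psi>\<close>, which is what \<open>\<phi>\<close> needs at coordinate 0.\<close>

lemma has_range_mult:
  assumes "subshift X" "\<phi> \<in> shift_auts X" "\<psi> \<in> shift_auts X"
    and "has_range X R \<phi>" "has_range X R' \<psi>"
  shows "has_range X (R + R') (\<phi> \<otimes>\<^bsub>aut_group X\<^esub> \<psi>)"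
  using assms(4) agree_image[OF assms(1,3,5)] shift_auts_mem[OF assms(3)]
  by (auto simp: has_range_def mult_aut_group[OF assms(2,3)] compose_def)

lemma has_range_word:
  assumes "subshift X" "set w \<subseteq> shift_auts X" "\<And>s. s \<in> set w \<Longrightarrow> has_range X M s"
  shows "foldr (\<otimes>\<^bsub>aut_group X\<^esub>) w \<one>\<^bsub>aut_group X\<^esub> \<in> shift_auts X \<and>
    has_range X (length w * M) (foldr (\<otimes>\<^bsub>aut_group X\<^esub>) w \<one>\<^bsub>aut_group X\<^esub>)"
proof -
  interpret group "aut_group X" by (rule group_aut_group[OF assms(1)])
  show ?thesis using assms(2,3)
  proof (induction w)
    case Nil
    then show ?case
      using one_closed has_range_one[of X] by (simp add: carrier_aut_group)
  next
    case (Cons s w)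
    let ?h = "foldr (\<otimes>\<^bsub>aut_group X\<^esub>) w \<one>\<^bsub>aut_group X\<^esub>"
    have s: "s \<in> shift_auts X" "has_range X M s"
      and h: "?h \<in> shift_auts X" "has_range X (length w * M) ?h"
      using Cons by auto
    show ?case
      using m_closed[of s ?h] has_range_mult[OF assms(1) s(1) h(1) s(2) h(2)] s h
      by (simp add: carrier_aut_group)
  qed
qed

section \<open>Word length and distortion\<close>

text \<open>This makes the set under the \<open>LEAST\<close> in \<open>word_length\<close>
  nonempty, so that a shortest word exists.\<close>

lemma (in group) generate_imp_word:
  assumes "S \<subseteq> carrier G" "h \<in> generate G S"
  shows "\<exists>w. set w \<subseteq> S \<union> (\<lambda>s. inv s) ` S \<and> foldr (\<otimes>) w \<one> = h"
  using assms(2)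
proof (induction rule: generate.induct)
  case one
  then show ?case by (intro exI[of _ "[]"]) auto
next
  case (incl h)
  then show ?case using assms(1) by (intro exI[of _ "[h]"]) auto
next
  case (inv h)
  then show ?case using assms(1) by (intro exI[of _ "[inv h]"]) auto
next
  case (eng h1 h2)
  from eng.IH obtain v w where vw: "set v \<subseteq> S \<union> (\<lambda>s. inv s) ` S" "foldr (\<otimes>) v \<one> = h1"
    "set w \<subseteq> S \<union> (\<lambda>s. inv s) ` S" "foldr (\<otimes>) w \<one> = h2" by blast
  have closed: "foldr (\<otimes>) u \<one> \<in> carrier G" if "set u \<subseteq> carrier G" for u
    using that by (induction u) auto
  \<comment> \<open>Concatenated words fold to the product of their values, by
    associativity.\<close>
  have append: "foldr (\<otimes>) u h2 = foldr (\<otimes>) u \<one> \<otimes> h2"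
    if "set u \<subseteq> carrier G" "h2 \<in> carrier G" for u
    using that closed by (induction u) (auto simp: m_assoc)
  have sub: "S \<union> (\<lambda>s. inv s) ` S \<subseteq> carrier G" using assms(1) by auto
  show ?case
  proof (intro exI conjI)
    show "set (v @ w) \<subseteq> S \<union> (\<lambda>s. inv s) ` S" using vw(1,3) by simp
    have "h2 \<in> carrier G" using closed[OF order_trans[OF vw(3) sub]] vw(4) by simp
    from append[OF order_trans[OF vw(1) sub] this]
    show "foldr (\<otimes>) (v @ w) \<one> = h1 \<otimes> h2" using vw(2,4) by simp
  qed
qed

lemma (in group) word_length_word:
  assumes "S \<subseteq> carrier G" "h \<in> generate G S"
  obtains w where "length w = word_length G S h" "set w \<subseteq> S \<union> (\<lambda>s. inv s) ` S"
    "foldr (\<otimes>) w \<one> = h"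
proof -
  have "\<exists>n w. length w = n \<and> set w \<subseteq> S \<union> (\<lambda>s. inv s) ` S \<and> foldr (\<otimes>) w \<one> = h"
    using generate_imp_word[OF assms] by blast
  from LeastI_ex[OF this] that show thesis unfolding word_length_def by blast
qed

lemma distorted_imp_range_distorted:
  assumes X: "subshift X" and G: "subgroup G (aut_group X)"
    and g: "distorted ((aut_group X)\<lparr>carrier := G\<rparr>) g"
  shows "range_distorted X g"
proof -
  define H where "H = (aut_group X)\<lparr>carrier := G\<rparr>"
  interpret H: group H
    unfolding H_def by (rule group.subgroup_imp_group[OF group_aut_group[OF X] G])
  have H [simp]: "carrier H = G" "(\<otimes>\<^bsub>H\<^esub>) = (\<otimes>\<^bsub>aut_group X\<^esub>)" "\<one>\<^bsub>H\<^esub> = \<one>\<^bsub>aut_group X\<^esub>"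
    by (simp_all add: H_def)
  \<comment> \<open>Natural powers depend only on multiplication and unit, which the subgroup
    inherits.\<close>
  have pow: "h [^]\<^bsub>H\<^esub> n = h [^]\<^bsub>aut_group X\<^esub> n" for h and n :: nat
    by (simp add: nat_pow_def)
  have GX: "G \<subseteq> shift_auts X" using subgroup.subset[OF G] by (simp add: carrier_aut_group)
  obtain S where S: "finite S" "S \<subseteq> G" "g \<in> generate H S"
    and lim: "(\<lambda>n. real (word_length H S (g [^]\<^bsub>aut_group X\<^esub> n)) / real n) \<longlonglongrightarrow> 0"
    and gG: "g \<in> G"
    using g unfolding distorted_def H_def[symmetric] pow by auto
  \<comment> \<open>The range of an inverse is not bounded by the range of the element, so
    \<open>M\<close> is a maximum over the letters and their inverses. If \<open>L\<close> is empty,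
    only the empty word occurs and the value of \<open>M\<close> is irrelevant.\<close>
  define L where "L = S \<union> (\<lambda>s. inv\<^bsub>H\<^esub> s) ` S"
  have L: "finite L" "L \<subseteq> G" using S H.inv_closed by (auto simp: L_def)
  define M where "M = Max (aut_range X ` L)"
  have M: "has_range X M s" if "s \<in> L" for s
    using that L GX
    by (intro has_range_mono[OF has_range_aut_range[OF X]]) (auto simp: M_def)
  have gen: "g [^]\<^bsub>aut_group X\<^esub> n \<in> generate H S" for n :: nat
    using S(3) generate.one[of H S] generate.eng[of _ H S]
    by (induction n) (simp_all add: nat_pow_def)
  have bound: "aut_range X (g [^]\<^bsub>aut_group X\<^esub> n) \<le> word_length H S (g [^]\<^bsub>aut_group X\<^esub> n) * M"
    for n :: nat
  proof -
    obtain w where w: "length w = word_length H S (g [^]\<^bsub>aut_group X\<^esub> n)" "set w \<subseteq> L"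
      "foldr (\<otimes>\<^bsub>H\<^esub>) w \<one>\<^bsub>H\<^esub> = g [^]\<^bsub>aut_group X\<^esub> n"
      using H.word_length_word[OF _ gen] S(2) unfolding L_def H(1) by blast
    have "has_range X (length w * M) (foldr (\<otimes>\<^bsub>H\<^esub>) w \<one>\<^bsub>H\<^esub>)"
      unfolding H(2,3) using w(2) M L(2) GX by (intro has_range_word[OF X, THEN conjunct2]) auto
    then show ?thesis unfolding w(1,3) by (rule aut_range_le)
  qed
  have "(\<lambda>n. real (aut_range X (g [^]\<^bsub>aut_group X\<^esub> n)) / real n) \<longlonglongrightarrow> 0"
  proof (rule tendsto_sandwich[OF _ _ tendsto_const])
    show "(\<lambda>n. real M * (real (word_length H S (g [^]\<^bsub>aut_group X\<^esub> n)) / real n)) \<longlonglongrightarrow> 0"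
      using tendsto_mult[OF tendsto_const lim] by simp
    show "\<forall>\<^sub>F n in sequentially. real (aut_range X (g [^]\<^bsub>aut_group X\<^esub> n)) / real n \<le>
        real M * (real (word_length H S (g [^]\<^bsub>aut_group X\<^esub> n)) / real n)"
      using bound
      by (intro always_eventually allI)
        (simp add: divide_right_mono mult.commute flip: of_nat_mult)
  qed auto
  then show ?thesis using gG GX by (auto simp: range_distorted_def carrier_aut_group)
qed

section \<open>Entropy of range distorted automorphisms\<close>

text \<open>One member of the cover is chosen for each word of length \<open>2 * M + 1\<close> that
  occurs centrally in \<open>X\<close>.\<close>

lemma min_subcover_cylinders:
  fixes X :: "(int \<Rightarrow> 'a::finite) set"
  assumes "\<And>x. x \<in> X \<Longrightarrow> \<exists>U\<in>\<U>. {y \<in> X. agree M x y} \<subseteq> U"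
  shows "min_subcover (subtopology full_shift X) \<U> \<le> CARD('a) ^ (2 * M + 1)"
proof -
  obtain J where J: "\<And>x. x \<in> X \<Longrightarrow> J x \<in> \<U>" "\<And>x. x \<in> X \<Longrightarrow> {y \<in> X. agree M x y} \<subseteq> J x"
    using assms by metis
  define I where "I = {- int M..int M}"
  define p where "p x = restrict x I" for x :: "int \<Rightarrow> 'a"
  \<comment> \<open>A representative in \<open>X\<close> for each central word; a point lies in the
    cylinder of the representative of its own word.\<close>
  define r where "r = inv_into X p"
  have r: "r (p x) \<in> X" "agree M (r (p x)) x" if "x \<in> X" for x
    using that inv_into_into[of "p x" p X] f_inv_into_f[of "p x" p X]
    by (auto simp: r_def p_def I_def agree_restrict_iff)
  let ?V = "(\<lambda>c. J (r c)) ` p ` X"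
  have fin: "finite (I \<rightarrow>\<^sub>E (UNIV :: 'a set))" by (intro finite_PiE) (auto simp: I_def)
  have sub: "p ` X \<subseteq> I \<rightarrow>\<^sub>E UNIV" by (auto simp: p_def)
  have "card ?V \<le> card (p ` X)" using finite_subset[OF sub fin] by (rule card_image_le)
  also have "\<dots> \<le> card (I \<rightarrow>\<^sub>E (UNIV :: 'a set))" using fin sub by (rule card_mono)
  also have "\<dots> = CARD('a) ^ (2 * M + 1)"
    by (subst card_PiE) (auto simp: I_def nat_add_distrib nat_mult_distrib)
  finally have card: "card ?V \<le> CARD('a) ^ (2 * M + 1)" .
  have "?V \<subseteq> \<U>" using r J by auto
  moreover have "finite ?V" using finite_subset[OF sub fin] by blast
  moreover have "topspace (subtopology full_shift X) \<subseteq> \<Union>?V" using r J(2) agree_sym by (fastforce simp: subset_iff)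
  ultimately have "min_subcover (subtopology full_shift X) \<U> \<le> card ?V"
    unfolding min_subcover_def by (intro Least_le) blast
  with card show ?thesis by simp
qed

text \<open>Ranges concern powers in the group, entropy concerns \<open>funpow\<close>. Group
  elements are extensional, so the two are compared on \<open>X\<close> only.\<close>

lemma pow_aut_group:
  fixes n :: nat
  assumes "subshift X" "g \<in> shift_auts X" "x \<in> X"
  shows "(g [^]\<^bsub>aut_group X\<^esub> n) x = (g ^^ n) x"
proof -
  interpret group "aut_group X" by (rule group_aut_group[OF assms(1)])
  have "g [^]\<^bsub>aut_group X\<^esub> n \<in> shift_auts X" for n :: nat
    using nat_pow_closed[of g] assms(2) by (simp add: carrier_aut_group)
  \<comment> \<open>The point varies in the induction, since the group power multiplies the new
    factor on the right and hence applies it first.\<close>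
  then show ?thesis using assms(3)
  proof (induction n arbitrary: x)
    case 0
    then show ?case by (simp add: one_aut_group)
  next
    case (Suc n)
    then show ?case
      using assms(2) shift_auts_mem[OF assms(2)]
      by (simp add: mult_aut_group compose_eq funpow_Suc_right del: funpow.simps)
  qed
qed

text \<open>For \<open>i < n\<close> the iterate \<open>g ^^ i\<close> sends the cylinder of radius
  \<open>N + K\<close> around \<open>x\<close> into the cylinder of radius \<open>N\<close> around
  \<open>(g ^^ i) x\<close>, hence into a member of the cover. These members define an element of
  the join.\<close>

lemma min_subcover_join:
  fixes X :: "(int \<Rightarrow> 'a::finite) set"
  assumes X: "subshift X" and g: "g \<in> shift_auts X"
    and N: "\<And>x. x \<in> X \<Longrightarrow> \<exists>U\<in>\<U>. {y \<in> X. agree N x y} \<subseteq> U"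
    and K: "\<And>i. i < n \<Longrightarrow> aut_range X (g [^]\<^bsub>aut_group X\<^esub> i) \<le> K"
  shows "min_subcover (subtopology full_shift X) (join_preimages (subtopology full_shift X) g \<U> n)
    \<le> CARD('a) ^ (2 * (N + K) + 1)"
proof (rule min_subcover_cylinders)
  interpret group "aut_group X" by (rule group_aut_group[OF X])
  have pow: "g [^]\<^bsub>aut_group X\<^esub> i \<in> shift_auts X" for i :: nat
    using nat_pow_closed[of g] g by (simp add: carrier_aut_group)
  have pow_mem: "(g ^^ i) z \<in> X" if "z \<in> X" for i z
    using shift_auts_mem[OF pow that] pow_aut_group[OF X g that] by simp
  fix x assume x: "x \<in> X"
  have "\<exists>U\<in>\<U>. {y \<in> X. agree N ((g ^^ i) x) y} \<subseteq> U" for i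
    using N pow_mem[OF x] by blast
  then obtain U where U: "\<And>i. U i \<in> \<U>" "\<And>i. {y \<in> X. agree N ((g ^^ i) x) y} \<subseteq> U i"
    by metis
  have "(g ^^ i) y \<in> U i" if y: "y \<in> X" "agree (N + K) x y" and i: "i < n" for y i
  proof -
    have "has_range X K (g [^]\<^bsub>aut_group X\<^esub> i)"
      using has_range_mono[OF has_range_aut_range[OF X pow] K[OF i]] .
    from agree_image[OF X pow this x y] have "agree N ((g ^^ i) x) ((g ^^ i) y)"
      using pow_aut_group[OF X g] x y by simp
    then show ?thesis using U(2) pow_mem[OF y(1)] by blast
  qed
  then show "\<exists>J\<in>join_preimages (subtopology full_shift X) g \<U> n.
      {y \<in> X. agree (N + K) x y} \<subseteq> J"
    using U(1)
    by (intro bexI[of _ "{y \<in> topspace (subtopology full_shift X). \<forall>i<n. (g ^^ i) y \<in> U i}"])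
      (auto simp: join_preimages_def)
qed

text \<open>The range of \<open>g^n\<close> need not be monotone in \<open>n\<close>. A bound of
  this form is, so its value at \<open>n\<close> also bounds the ranges of all earlier
  powers.\<close>

lemma sublinear_bound:
  fixes r :: "nat \<Rightarrow> nat"
  assumes "(\<lambda>n. real (r n) / real n) \<longlonglongrightarrow> 0" "e > 0"
  obtains C where "\<And>n. real (r n) \<le> real C + e * real n"
proof -
  obtain m where m: "\<And>n. n \<ge> m \<Longrightarrow> \<bar>real (r n) / real n\<bar> < e"
    using LIMSEQ_D[OF assms] by auto
  show thesis
  proof (rule that)
    fix n
    \<comment> \<open>The sum dominates the initial values, where the quotient is not yet
      controlled.\<close>
    show "real (r n) \<le> real (\<Sum>k\<le>m. r k) + e * real n"
    proof (cases "n \<le> m")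
      case True
      then have "r n \<le> (\<Sum>k\<le>m. r k)" by (intro member_le_sum) auto
      with \<open>e > 0\<close> show ?thesis by (simp add: add_increasing2 flip: of_nat_sum)
    next
      case False
      with m[of n] have "real (r n) \<le> e * real n" by (simp add: field_simps)
      then show ?thesis by (simp add: add_increasing sum_nonneg)
    qed
  qed
qed

text \<open>The entropy of a cover is given by \<open>lim\<close>, so actual convergence to 0 is
  proved first.\<close>

lemma cover_entropy_range_distorted:
  fixes X :: "(int \<Rightarrow> 'a::finite) set"
  assumes X: "subshift X" and g: "range_distorted X g"
    and U: "open_cover (subtopology full_shift X) \<U>"
  shows "cover_entropy (subtopology full_shift X) g \<U> = 0"
proof -
  let ?c = "\<lambda>n. real (min_subcover (subtopology full_shift X)
    (join_preimages (subtopology full_shift X) g \<U> n))"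
  define r where "r n = aut_range X (g [^]\<^bsub>aut_group X\<^esub> n)" for n :: nat
  have gX: "g \<in> shift_auts X" and r: "(\<lambda>n. real (r n) / real n) \<longlonglongrightarrow> 0"
    using g by (auto simp: range_distorted_def carrier_aut_group r_def)
  obtain N where N: "\<And>x. x \<in> X \<Longrightarrow> \<exists>U\<in>\<U>. {y \<in> X. agree N x y} \<subseteq> U"
    using Lebesgue_number_subshift[OF X U] by blast
  define l where "l = ln (real CARD('a))"
  have card: "CARD('a) \<ge> 1" by (simp add: Suc_leI)
  have l: "l \<ge> 0" using card unfolding l_def by (intro ln_ge_zero) linarith
  \<comment> \<open>An empty subshift has minimal subcovers of cardinality 0, where \<open>ln 0 = 0\<close>.\<close>
  have ln_nat: "ln (real k) \<ge> 0" for k :: nat by (cases k) auto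
  have "(\<lambda>n. ln (?c n) / real n) \<longlonglongrightarrow> 0"
  proof (rule LIMSEQ_I)
    fix e :: real assume e: "e > 0"
    \<comment> \<open>This makes \<open>2 * d * l\<close> at most \<open>e / 2\<close>; the summand
      1 avoids division by zero for a one-letter alphabet, where \<open>l = 0\<close>.\<close>
    define d where "d = e / (4 * (l + 1))"
    have d: "d > 0"
      using e l by (auto simp: d_def field_simps)
    have d': "2 * d * l \<le> e / 2" using e l by (auto simp: d_def field_simps)
    obtain C where C: "\<And>n. real (r n) \<le> real C + d * real n"
      using sublinear_bound[OF r d] by blast
    have bound: "ln (?c n) \<le> (2 * (real N + real C) + 1) * l + e / 2 * real n" for n
    proof -
      \<comment> \<open>A common bound for the ranges of all powers below \<open>n\<close>.\<close>
      define K where "K = nat \<lfloor>real C + d * real n\<rfloor>"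
      have Kle: "real K \<le> real C + d * real n" using d unfolding K_def by simp
      have "r i \<le> K" if "i < n" for i
      proof -
        have "real (r i) \<le> real C + d * real n"
          using C[of i] that d by (smt (verit) mult_left_mono of_nat_less_iff)
        then show ?thesis unfolding K_def by (rule le_nat_floor)
      qed
      then have "?c n \<le> real (CARD('a) ^ (2 * (N + K) + 1))"
        unfolding of_nat_le_iff r_def by (intro min_subcover_join[OF X gX N])
      then have "ln (?c n) \<le> ln (real (CARD('a) ^ (2 * (N + K) + 1)))"
      proof (cases "?c n = 0")
        case True
        then have "ln (?c n) = 0" by simp
        then show ?thesis using ln_nat by (simp only:)
      qed (simp add: ln_mono)
      also have "\<dots> = (2 * (real N + real K) + 1) * l"
        using card by (subst of_nat_power, subst ln_realpow) (auto simp: l_def)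
      also have "\<dots> \<le> (2 * (real N + real C + d * real n) + 1) * l"
        using Kle l by (intro mult_right_mono) auto
      also have "\<dots> = (2 * (real N + real C) + 1) * l + 2 * d * l * real n"
        by (simp add: algebra_simps)
      also have "\<dots> \<le> (2 * (real N + real C) + 1) * l + e / 2 * real n"
        using d' by (intro add_left_mono mult_right_mono) auto
      finally show ?thesis .
    qed
    \<comment> \<open>Beyond \<open>m\<close> the constant term is below
      \<open>e / 2 * real n\<close>; starting at \<open>Suc m\<close> also keeps \<open>n\<close>
      positive for the division.\<close>
    obtain m :: nat where m: "(2 * (real N + real C) + 1) * l / (e / 2) < real m"
      using reals_Archimedean2 by blast
    show "\<exists>no. \<forall>n\<ge>no. norm (ln (?c n) / real n - 0) < e"
    proof (intro exI allI impI)
      fix n assume n: "n \<ge> Suc m"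
      have "(2 * (real N + real C) + 1) * l < e / 2 * real m"
        using m e by (simp add: field_simps)
      also have "\<dots> \<le> e / 2 * real n" using n e by simp
      finally have "ln (?c n) < e * real n" using bound[of n] by (simp add: field_simps)
      then have "ln (?c n) / real n < e" using n by (simp add: field_simps)
      then show "norm (ln (?c n) / real n - 0) < e" using ln_nat by simp
    qed
  qed
  then show ?thesis unfolding cover_entropy_def by (rule limI)
qed

lemma topological_entropy_range_distorted:
  assumes "subshift X" "range_distorted X g"
  shows "topological_entropy (subtopology full_shift X) g = 0"
proof -
  let ?T = "subtopology full_shift X"
  \<comment> \<open>The trivial cover keeps the supremum from being over the empty set, where it
    would be minus infinity.\<close>
  have "open_cover ?T {topspace ?T}"
    by (auto simp only: open_cover_def intro: openin_topspace)
  then have "{\<U>. open_cover ?T \<U>} \<noteq> {}" by blast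
  then show ?thesis
    unfolding topological_entropy_def
    using cover_entropy_range_distorted[OF assms] by (simp add: zero_ereal_def)
qed

theorem proposition3p4:
  fixes X :: "(int \<Rightarrow> 'a::finite) set"
    and G :: "((int \<Rightarrow> 'a) \<Rightarrow> int \<Rightarrow> 'a) set"
    and g :: "(int \<Rightarrow> 'a) \<Rightarrow> int \<Rightarrow> 'a"
  assumes "subshift X"
    and "subgroup G (aut_group X)"
    and "\<exists>S. finite S \<and> S \<subseteq> carrier (aut_group X) \<and> generate (aut_group X) S = G"
    and "g \<in> G"
    and "distorted ((aut_group X)\<lparr>carrier := G\<rparr>) g"
  shows "range_distorted X g \<and> topological_entropy (subtopology full_shift X) g = 0"
  using distorted_imp_range_distorted[OF assms(1,2,5)]
    topological_entropy_range_distorted[OF assms(1)] by blast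

end
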